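(* Let $n\ge 4$ be an integer and let $S$ be an inverse-closed subset of $\mathbb{Z}_n\setminus\{0\}$ such that $\langle S\rangle=\mathbb{Z}_n$ and $|S|$ divides $n$. Then $\mathrm{Cay}(\mathbb{Z}_n,S)$ admits a subgroup of $\mathbb{Z}_n$ as a total perfect code if and only if $s\not\equiv s'\pmod{|S|}$ for all distinct $s,s'\in S$.
   Context: Inverse-closed means $-S=S$. The Cayley graph $\mathrm{Cay}(\mathbb{Z}_n,S)$ has vertex set $\mathbb{Z}_n$, with $x,y$ adjacent iff $y-x\in S$. A total perfect code in a graph is a set $C$ of vertices such that every vertex of the graph (including those in $C$) is adjacent to exactly one vertex of $C$. *)

theory Defs
  imports "HOL-Algebra.Elementary_Groups" "HOL-Number_Theory.Cong" "Graph_Theory.Pair_Digraph"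
begin

text \<open>
  Undirected graphs are symmetric loop-free digraphs, as in \<^locale>\<open>pair_graph\<close>.
  Vertices \<open>x\<close>, \<open>y\<close> are adjacent iff \<open>y\<cdot>x\<^sup>-\<^sup>1 \<in> S\<close>,
  which reads \<open>y - x \<in> S\<close> in \<^term>\<open>integer_mod_group n\<close>.
\<close>

definition cayley_graph :: "('a, 'b) monoid_scheme \<Rightarrow> 'a set \<Rightarrow> 'a pair_pre_digraph" where
  "cayley_graph G S =
    \<lparr> pverts = carrier G,
      parcs = {(x, y). x \<in> carrier G \<and> y \<in> carrier G \<and> y \<otimes>\<^bsub>G\<^esub> inv\<^bsub>G\<^esub> x \<in> S} \<rparr>"

lemma pair_graph_cayley_graph:
  assumes "group G" "finite (carrier G)" "S \<subseteq> carrier G - {\<one>\<^bsub>G\<^esub>}" "set_inv\<^bsub>G\<^esub> S = S"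
  shows "pair_graph (cayley_graph G S)"
proof -
  interpret group G by fact
  let ?A = "parcs (cayley_graph G S)"
  have "?A \<subseteq> carrier G \<times> carrier G"
    by (auto simp: cayley_graph_def)
  then have fin: "finite ?A"
    using assms(2) finite_subset by blast
  have swap: "(y, x) \<in> ?A" if "(x, y) \<in> ?A" for x y
  proof -
    have xy: "x \<in> carrier G" "y \<in> carrier G" "y \<otimes>\<^bsub>G\<^esub> inv\<^bsub>G\<^esub> x \<in> S"
      using that by (auto simp: cayley_graph_def)
    then have "inv\<^bsub>G\<^esub> (y \<otimes>\<^bsub>G\<^esub> inv\<^bsub>G\<^esub> x) \<in> set_inv\<^bsub>G\<^esub> S"
      by (auto simp: SET_INV_def)
    then show ?thesis
      using xy assms(4) by (simp add: cayley_graph_def inv_mult_group)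
  qed
  show ?thesis
    using assms(2,3) fin swap
    by unfold_locales (auto simp: cayley_graph_def symmetric_def sym_def)
qed

definition total_perfect_code :: "('a, 'b) pre_digraph \<Rightarrow> 'a set \<Rightarrow> bool" where
  "total_perfect_code G C \<longleftrightarrow>
    C \<subseteq> verts G \<and> (\<forall>v \<in> verts G. \<exists>!c. c \<in> C \<and> v \<rightarrow>\<^bsub>G\<^esub> c)"

end

theory Submission
  imports Defs "HOL-Algebra.Multiplicative_Group"
begin

text \<open>
  A vertex \<open>v\<close> is joined to \<open>c\<close> when \<open>s = c \<cdot> v\<^sup>-\<^sup>1\<close> lies in \<open>S\<close>, that is, when \<open>v = s\<^sup>-\<^sup>1 \<cdot> c\<close>. So \<open>C\<close>
  is a total perfect code of \<open>Cay(G, S)\<close> exactly when every \<open>v\<close> is \<open>s\<^sup>-\<^sup>1 \<cdot> c\<close> for exactly one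
  pair \<open>(c, s)\<close> in \<open>C \<times> S\<close>.
  Counting pairs gives \<open>|C| \<cdot> |S| = |G|\<close> (\<open>card_total_perfect_code\<close>).
  A subgroup of \<open>\<int>\<^sub>n\<close> is determined by its order, so with \<open>k = |S|\<close> the only subgroup that
  can be a total perfect code is \<open>k\<int>\<^sub>n\<close> (\<open>subgroup_integer_mod_group_eq_multiples\<close>).
  A subgroup is a total perfect code exactly when \<open>S\<close> meets each of its cosets once, and the
  cosets of \<open>k\<int>\<^sub>n\<close> are the residue classes modulo \<open>k\<close>
  (\<open>total_perfect_code_multiples_iff\<close>). As \<open>S\<close> has \<open>k\<close> elements, it meets each of these
  \<open>k\<close> classes once iff no two of its elements are congruent modulo \<open>k\<close>.
\<close>

lemma total_perfect_code_cayley_graph_iff: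
  "total_perfect_code (with_proj (cayley_graph G S)) C \<longleftrightarrow>
    C \<subseteq> carrier G \<and> (\<forall>v\<in>carrier G. \<exists>!c. c \<in> C \<and> c \<otimes>\<^bsub>G\<^esub> inv\<^bsub>G\<^esub> v \<in> S)"
proof -
  have "(\<exists>!c. c \<in> C \<and> (v, c) \<in> parcs (cayley_graph G S)) \<longleftrightarrow>
      (\<exists>!c. c \<in> C \<and> c \<otimes>\<^bsub>G\<^esub> inv\<^bsub>G\<^esub> v \<in> S)"
    if "C \<subseteq> carrier G" "v \<in> carrier G" for v
  proof -
    have "(c \<in> C \<and> (v, c) \<in> parcs (cayley_graph G S)) \<longleftrightarrow> (c \<in> C \<and> c \<otimes>\<^bsub>G\<^esub> inv\<^bsub>G\<^esub> v \<in> S)"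
      for c
      using that by (auto simp: cayley_graph_def)
    then show ?thesis
      by simp
  qed
  moreover have "pverts (cayley_graph G S) = carrier G"
    by (simp add: cayley_graph_def)
  ultimately show ?thesis
    by (simp add: total_perfect_code_def cong: conj_cong)
qed

lemma (in group) card_total_perfect_code:
  assumes S: "S \<subseteq> carrier G"
    and code: "total_perfect_code (with_proj (cayley_graph G S)) C"
  shows "card C * card S = order G"
proof -
  have C: "C \<subseteq> carrier G"
    and ex1: "\<And>v. v \<in> carrier G \<Longrightarrow> \<exists>!c. c \<in> C \<and> c \<otimes> inv v \<in> S"
    using code by (auto simp: total_perfect_code_cayley_graph_iff)
  \<comment> \<open>The pair \<open>(c, s)\<close> stands for the arc that reaches \<open>c\<close> along \<open>s\<close>; its tail is \<open>s\<^sup>-\<^sup>1 \<cdot> c\<close>.\<close>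
  have step: "c \<otimes> inv (inv s \<otimes> c) = s" if "c \<in> carrier G" "s \<in> carrier G" for c s
    using that by (simp add: inv_mult_group m_assoc[symmetric])
  have "bij_betw (\<lambda>(c, s). inv s \<otimes> c) (C \<times> S) (carrier G)"
  proof (rule bij_betwI')
    fix p q assume "p \<in> C \<times> S" "q \<in> C \<times> S"
    then obtain c s d t where pq: "p = (c, s)" "q = (d, t)" "c \<in> C" "s \<in> S" "d \<in> C" "t \<in> S"
      by auto
    then have car: "c \<in> carrier G" "s \<in> carrier G" "d \<in> carrier G" "t \<in> carrier G"
      using S C by auto
    show "((\<lambda>(c, s). inv s \<otimes> c) p = (\<lambda>(c, s). inv s \<otimes> c) q) = (p = q)"
    proof
      assume "(\<lambda>(c, s). inv s \<otimes> c) p = (\<lambda>(c, s). inv s \<otimes> c) q"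
      then have eq: "inv s \<otimes> c = inv t \<otimes> d"
        by (simp add: pq)
      have s: "c \<otimes> inv (inv s \<otimes> c) = s"
        using car by (intro step)
      have t: "d \<otimes> inv (inv s \<otimes> c) = t"
        unfolding eq using car by (intro step)
      have "inv s \<otimes> c \<in> carrier G"
        using car by simp
      from ex1[OF this] have "c = d"
        using s t pq(3-6) by metis
      moreover from this have "s = t"
        using s t by metis
      ultimately show "p = q"
        by (simp add: pq)
    qed simp
  next
    fix p assume "p \<in> C \<times> S"
    then show "(\<lambda>(c, s). inv s \<otimes> c) p \<in> carrier G"
      using S C by auto
  next
    fix v assume v: "v \<in> carrier G"
    then obtain c where c: "c \<in> C" "c \<otimes> inv v \<in> S"
      using ex1 by blast
    then have "inv (c \<otimes> inv v) \<otimes> c = v"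
      using v C by (auto simp: inv_mult_group m_assoc)
    with c show "\<exists>p\<in>C \<times> S. v = (\<lambda>(c, s). inv s \<otimes> c) p"
      by (intro bexI[of _ "(c, c \<otimes> inv v)"]) auto
  qed
  then have "card (C \<times> S) = card (carrier G)"
    by (rule bij_betw_same_card)
  then show ?thesis
    by (simp add: card_cartesian_product order_def)
qed

lemma subgroup_multiples:
  assumes "n > 0" "k dvd n"
  shows "subgroup {x \<in> carrier (integer_mod_group n). int k dvd x} (integer_mod_group n)"
proof -
  interpret group "integer_mod_group n" by simp
  have "int k dvd int n"
    using assms by simp
  then show ?thesis
    using assms by (intro subgroupI) (auto simp: carrier_integer_mod_group dvd_mod_iff intro!: exI[of _ 0])
qed

lemma card_multiples:
  assumes "n > 0" "k * m = n"
  shows "card {x \<in> carrier (integer_mod_group n). int k dvd x} = m"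
proof -
  have k: "k > 0"
    using assms by (cases k) auto
  have n: "int n = int k * int m"
    using assms by (metis of_nat_mult)
  have "{x \<in> carrier (integer_mod_group n). int k dvd x} = (\<lambda>i. int k * i) ` {0..<int m}"
    using assms k by (auto simp: carrier_integer_mod_group n zero_le_mult_iff)
  also have "card \<dots> = m"
    using k by (subst card_image) (auto simp: inj_on_def)
  finally show ?thesis .
qed

text \<open>
  An element \<open>x\<close> of a subgroup of order \<open>m\<close> satisfies \<open>m \<cdot> x = 0\<close> in \<open>\<int>\<^sub>n\<close>, which for \<open>n = m \<cdot> k\<close>
  says that \<open>k\<close> divides \<open>x\<close>. There are only \<open>m\<close> such elements, so the subgroup is all of them.
\<close>

lemma subgroup_integer_mod_group_eq_multiples:
  assumes n: "n > 0" and H: "subgroup H (integer_mod_group n)" and card: "card H * k = n"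
  shows "H = {x \<in> carrier (integer_mod_group n). int k dvd x}"
proof (rule card_subset_eq)
  interpret group "integer_mod_group n" by simp
  interpret HG: group "integer_mod_group n\<lparr>carrier := H\<rparr>"
    using H by (rule subgroup_imp_group)
  have fin: "finite (carrier (integer_mod_group n))"
    using n by (simp add: carrier_integer_mod_group)
  have sub: "H \<subseteq> carrier (integer_mod_group n)"
    using H by (rule subgroup.subset)
  show "finite {x \<in> carrier (integer_mod_group n). int k dvd x}"
    using fin by simp
  have "int k dvd x" if "x \<in> H" for x
  proof -
    have "x [^]\<^bsub>integer_mod_group n\<^esub> card H = 0"
      using HG.pow_order_eq_1[of x] that
      by (simp add: order_def nat_pow_consistent[of x "card H" H] del: pow_integer_mod_group)
    then have "int (card H) * int k dvd int (card H) * x"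
      by (simp add: mod_eq_0_iff_dvd flip: of_nat_mult card)
    moreover have "card H \<noteq> 0"
      using n card by auto
    ultimately show ?thesis
      by simp
  qed
  then show "H \<subseteq> {x \<in> carrier (integer_mod_group n). int k dvd x}"
    using sub by blast
  show "card H = card {x \<in> carrier (integer_mod_group n). int k dvd x}"
    using card_multiples[of n k "card H"] n card by (simp add: mult.commute)
qed

text \<open>
  The neighbours of \<open>v\<close> in \<open>k\<int>\<^sub>n\<close> are the \<open>v + s\<close> with \<open>s \<in> S\<close> and \<open>s \<equiv> -v\<close> modulo \<open>k\<close>, so the code
  condition at \<open>v\<close> says that the residue class of \<open>-v\<close> has exactly one element of \<open>S\<close>.
\<close>

lemma total_perfect_code_multiples_iff:
  assumes n: "n > 0" and k: "k dvd n" and S: "S \<subseteq> carrier (integer_mod_group n)"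
  shows "total_perfect_code (with_proj (cayley_graph (integer_mod_group n) S))
      {x \<in> carrier (integer_mod_group n). int k dvd x}
    \<longleftrightarrow> (\<forall>v\<in>carrier (integer_mod_group n). \<exists>!s. s \<in> S \<and> [s = - v] (mod int k))"
proof -
  let ?C = "{x \<in> carrier (integer_mod_group n). int k dvd x}"
  have kn: "int k dvd int n"
    using k by simp
  have mem: "x \<in> carrier (integer_mod_group n) \<longleftrightarrow> 0 \<le> x \<and> x < int n" for x
    using n by (simp add: carrier_integer_mod_group)
  have "(\<exists>!c. c \<in> ?C \<and> (c - v) mod int n \<in> S) \<longleftrightarrow> (\<exists>!s. s \<in> S \<and> [s = - v] (mod int k))"
    if v: "v \<in> carrier (integer_mod_group n)" for v
  proof -
    \<comment> \<open>\<open>c \<mapsto> c - v\<close> and \<open>s \<mapsto> s + v\<close> modulo \<open>n\<close> are mutually inverse between the two sets of candidates.\<close>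
    have to: "[(c - v) mod int n = - v] (mod int k)" "((c - v) mod int n + v) mod int n = c"
      if "c \<in> ?C" for c
    proof -
      have "int k dvd c"
        using that by simp
      then show "[(c - v) mod int n = - v] (mod int k)"
        by (simp add: cong_def mod_mod_cancel[OF kn] cong_iff_dvd_diff mod_eq_dvd_iff)
      show "((c - v) mod int n + v) mod int n = c"
        using that by (simp add: mem mod_add_left_eq)
    qed
    have fro: "(s + v) mod int n \<in> ?C" "((s + v) mod int n - v) mod int n = s"
      if "s \<in> S" "[s = - v] (mod int k)" for s
    proof -
      have "int k dvd s + v"
        using that by (simp add: cong_iff_dvd_diff)
      then show "(s + v) mod int n \<in> ?C"
        using n by (simp add: mem dvd_mod_iff[OF kn])
      show "((s + v) mod int n - v) mod int n = s"
        using that S mem[of s] by (auto simp: mod_diff_left_eq)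
    qed
    show ?thesis
    proof
      assume "\<exists>!c. c \<in> ?C \<and> (c - v) mod int n \<in> S"
      then obtain c where c: "c \<in> ?C" "(c - v) mod int n \<in> S"
        and uniq: "\<And>d. d \<in> ?C \<Longrightarrow> (d - v) mod int n \<in> S \<Longrightarrow> d = c"
        by blast
      show "\<exists>!s. s \<in> S \<and> [s = - v] (mod int k)"
      proof (rule ex1I)
        show "(c - v) mod int n \<in> S \<and> [(c - v) mod int n = - v] (mod int k)"
          using c to(1) by blast
        fix s assume "s \<in> S \<and> [s = - v] (mod int k)"
        then show "s = (c - v) mod int n"
          using fro[of s] uniq[of "(s + v) mod int n"] by metis
      qed
    next
      assume "\<exists>!s. s \<in> S \<and> [s = - v] (mod int k)"
      then obtain s where s: "s \<in> S" "[s = - v] (mod int k)"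
        and uniq: "\<And>t. t \<in> S \<Longrightarrow> [t = - v] (mod int k) \<Longrightarrow> t = s"
        by blast
      show "\<exists>!c. c \<in> ?C \<and> (c - v) mod int n \<in> S"
      proof (rule ex1I)
        show "(s + v) mod int n \<in> ?C \<and> ((s + v) mod int n - v) mod int n \<in> S"
          using s fro[of s] by metis
        fix c assume "c \<in> ?C \<and> (c - v) mod int n \<in> S"
        then show "c = (s + v) mod int n"
          using to[of c] uniq[of "(c - v) mod int n"] by metis
      qed
    qed
  qed
  moreover have "c \<otimes>\<^bsub>integer_mod_group n\<^esub> inv\<^bsub>integer_mod_group n\<^esub> v = (c - v) mod int n"
    if "v \<in> carrier (integer_mod_group n)" for c v
    using that by (simp add: mod_add_right_eq)
  ultimately have "(\<exists>!c. c \<in> ?C \<and>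
        c \<otimes>\<^bsub>integer_mod_group n\<^esub> inv\<^bsub>integer_mod_group n\<^esub> v \<in> S) \<longleftrightarrow>
      (\<exists>!s. s \<in> S \<and> [s = - v] (mod int k))"
    if "v \<in> carrier (integer_mod_group n)" for v
    using that by presburger
  moreover have "?C \<subseteq> carrier (integer_mod_group n)"
    by blast
  ultimately show ?thesis
    unfolding total_perfect_code_cayley_graph_iff by (simp only: simp_thms cong: ball_cong)
qed

lemma ex1_cong_iff_incongruent:
  fixes S :: "int set"
  assumes k: "card S > 0"
  shows "(\<forall>v. \<exists>!s. s \<in> S \<and> [s = v] (mod int (card S))) \<longleftrightarrow>
    (\<forall>s\<in>S. \<forall>s'\<in>S. s \<noteq> s' \<longrightarrow> \<not> [s = s'] (mod int (card S)))"
proof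
  assume "\<forall>v. \<exists>!s. s \<in> S \<and> [s = v] (mod int (card S))"
  then show "\<forall>s\<in>S. \<forall>s'\<in>S. s \<noteq> s' \<longrightarrow> \<not> [s = s'] (mod int (card S))"
    by (metis cong_refl)
next
  assume incong: "\<forall>s\<in>S. \<forall>s'\<in>S. s \<noteq> s' \<longrightarrow> \<not> [s = s'] (mod int (card S))"
  then have "inj_on (\<lambda>s. s mod int (card S)) S"
    by (auto simp: inj_on_def cong_def)
  \<comment> \<open>An injective map from \<open>S\<close> to a set of \<open>|S|\<close> residues reaches all of them.\<close>
  then have "(\<lambda>s. s mod int (card S)) ` S = {0..<int (card S)}"
    using k by (intro card_subset_eq) (auto simp: card_image)
  moreover have "v mod int (card S) \<in> {0..<int (card S)}" for v
    using k by simp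
  ultimately have "v mod int (card S) \<in> (\<lambda>s. s mod int (card S)) ` S" for v
    by blast
  then have "\<exists>s\<in>S. [s = v] (mod int (card S))" for v
    unfolding cong_def image_iff by metis
  then show "\<forall>v. \<exists>!s. s \<in> S \<and> [s = v] (mod int (card S))"
    using incong by (metis cong_sym cong_trans)
qed

theorem theorem5p2:
  fixes n :: nat and S :: "int set"
  assumes "n \<ge> 4"
    and "S \<subseteq> carrier (integer_mod_group n) - {0}"
    and "set_inv\<^bsub>integer_mod_group n\<^esub> S = S"
    and "generate (integer_mod_group n) S = carrier (integer_mod_group n)"
    and "card S dvd n"
  shows "(\<exists>H. subgroup H (integer_mod_group n) \<and>
              total_perfect_code (with_proj (cayley_graph (integer_mod_group n) S)) H)
    \<longleftrightarrow> (\<forall>s\<in>S. \<forall>s'\<in>S. s \<noteq> s' \<longrightarrow> \<not> [s = s'] (mod int (card S)))"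
proof -
  let ?G = "integer_mod_group n"
  let ?C = "{x \<in> carrier ?G. int (card S) dvd x}"
  let ?code = "total_perfect_code (with_proj (cayley_graph ?G S))"
  interpret group ?G by simp
  have n: "n > 0" and S: "S \<subseteq> carrier ?G"
    using assms(1,2) by auto
  have k: "card S > 0"
    using assms(5) n by (auto intro!: Nat.gr0I)
  have "H = ?C" if "subgroup H ?G" "?code H" for H
  proof (rule subgroup_integer_mod_group_eq_multiples[OF n that(1)])
    show "card H * card S = n"
      using card_total_perfect_code[OF S that(2)] n
      by (simp add: order_def carrier_integer_mod_group)
  qed
  then have "(\<exists>H. subgroup H ?G \<and> ?code H) \<longleftrightarrow> ?code ?C"
    using subgroup_multiples[OF n assms(5)] by blast
  also have "\<dots> \<longleftrightarrow> (\<forall>v\<in>carrier ?G. \<exists>!s. s \<in> S \<and> [s = - v] (mod int (card S)))"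
    by (rule total_perfect_code_multiples_iff[OF n assms(5) S])
  also have "\<dots> \<longleftrightarrow> (\<forall>v. \<exists>!s. s \<in> S \<and> [s = v] (mod int (card S)))"
  proof -
    have "\<exists>!s. s \<in> S \<and> [s = w] (mod int (card S))"
      if all: "\<forall>v\<in>carrier ?G. \<exists>!s. s \<in> S \<and> [s = - v] (mod int (card S))" for w
    proof -
      \<comment> \<open>As \<open>|S|\<close> divides \<open>n\<close>, the representative of \<open>-w\<close> in \<open>\<int>\<^sub>n\<close> keeps its class modulo \<open>|S|\<close>.\<close>
      have "(- w) mod int n mod int (card S) = (- w) mod int (card S)"
        using assms(5) by (simp add: mod_mod_cancel)
      then have "[- ((- w) mod int n) = w] (mod int (card S))"
        unfolding cong_def by (metis minus_minus mod_minus_eq)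
      then have "[s = - ((- w) mod int n)] (mod int (card S)) \<longleftrightarrow> [s = w] (mod int (card S))" for s
        by (simp add: cong_def)
      moreover have "(- w) mod int n \<in> carrier ?G"
        using n by (simp add: carrier_integer_mod_group)
      from bspec[OF all this]
      have "\<exists>!s. s \<in> S \<and> [s = - ((- w) mod int n)] (mod int (card S))" .
      ultimately show ?thesis
        by (simp only:)
    qed
    then show ?thesis
      by blast
  qed
  also have "\<dots> \<longleftrightarrow> (\<forall>s\<in>S. \<forall>s'\<in>S. s \<noteq> s' \<longrightarrow> \<not> [s = s'] (mod int (card S)))"
    by (rule ex1_cong_iff_incongruent[OF k])
  finally show ?thesis .
qed

end
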